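(* Let $R$ be a nonzero ring and $G$ a group. If the group ring $RG$ is strongly $\Delta$-clean, then $R$ is a strongly $\Delta$-clean ring and $G$ is a $2$-group.
   Context: Rings are associative with identity, not necessarily commutative. For a ring $S$, $U(S)$ is the group of units and $\Delta(S)=\{x\in S \mid 1-xu\in U(S)\text{ for all }u\in U(S)\}$. A ring $S$ is strongly $\Delta$-clean if every $a\in S$ can be written $a=e+d$ with $e^2=e\in S$, $d\in\Delta(S)$ and $ed=de$. A group $G$ (possibly infinite, not necessarily abelian) is a $2$-group if every element of $G$ has finite order equal to a power of $2$. *)

theory Defs
  imports "HOL-Algebra.Multiplicative_Group"
begin

definition Delta :: "('a, 'm) ring_scheme \<Rightarrow> 'a set" where
  "Delta S = {x \<in> carrier S. \<forall>u \<in> Units S. \<one>\<^bsub>S\<^esub> \<ominus>\<^bsub>S\<^esub> x \<otimes>\<^bsub>S\<^esub> u \<in> Units S}"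

definition strongly_Delta_clean :: "('a, 'm) ring_scheme \<Rightarrow> bool" where
  "strongly_Delta_clean S \<longleftrightarrow>
     (\<forall>a \<in> carrier S. \<exists>e \<in> carrier S. \<exists>d \<in> Delta S.
        a = e \<oplus>\<^bsub>S\<^esub> d \<and> e \<otimes>\<^bsub>S\<^esub> e = e \<and> e \<otimes>\<^bsub>S\<^esub> d = d \<otimes>\<^bsub>S\<^esub> e)"

text \<open>\<^const>\<open>group.ord\<close> is \<open>0\<close> on elements of infinite order, so the condition below forces every
  order to be finite.\<close>

definition two_group :: "('g, 'n) monoid_scheme \<Rightarrow> bool" where
  "two_group G \<longleftrightarrow> (\<forall>g \<in> carrier G. \<exists>k::nat. group.ord G g = 2 ^ k)"

definition coeff_supp :: "('a, 'm) ring_scheme \<Rightarrow> ('g, 'n) monoid_scheme \<Rightarrow> ('g \<Rightarrow> 'a) \<Rightarrow> 'g set" where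
  "coeff_supp R G f = {g \<in> carrier G. f g \<noteq> \<zero>\<^bsub>R\<^esub>}"

text \<open>A formal sum is represented by its coefficient function, made extensional outside
  \<^term>\<open>carrier G\<close> so that equality of formal sums is equality of functions. The coefficient of a
  product at \<open>g\<close> is the sum of \<open>p x \<cdot> q y\<close> over all \<open>x y = g\<close>, that is, over all
  \<open>x\<close> with \<open>y = x\<inverse> g\<close>; restricting to the support of \<open>p\<close> keeps the sum finite, as
  \<^const>\<open>finsum\<close> requires.\<close>

definition group_ring ::
  "('a, 'm) ring_scheme \<Rightarrow> ('g, 'n) monoid_scheme \<Rightarrow> ('g \<Rightarrow> 'a) ring" where
  "group_ring R G =
    \<lparr>carrier = {p \<in> carrier G \<rightarrow>\<^sub>E carrier R. finite (coeff_supp R G p)},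
     mult = (\<lambda>p q. \<lambda>g \<in> carrier G.
       \<Oplus>\<^bsub>R\<^esub>x \<in> coeff_supp R G p. p x \<otimes>\<^bsub>R\<^esub> q (inv\<^bsub>G\<^esub> x \<otimes>\<^bsub>G\<^esub> g)),
     one = (\<lambda>g \<in> carrier G. if g = \<one>\<^bsub>G\<^esub> then \<one>\<^bsub>R\<^esub> else \<zero>\<^bsub>R\<^esub>),
     zero = (\<lambda>g \<in> carrier G. \<zero>\<^bsub>R\<^esub>),
     add = (\<lambda>p q. \<lambda>g \<in> carrier G. p g \<oplus>\<^bsub>R\<^esub> q g)\<rparr>"

context
  fixes R :: "('a, 'm) ring_scheme" (structure)
    and G :: "('g, 'n) monoid_scheme"
  assumes R: "ring R" and G: "group G"
begin

interpretation R: ring R by (rule R)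
interpretation G: group G by (rule G)

private abbreviation (input) "S \<equiv> coeff_supp R G"
private abbreviation (input) "A \<equiv> group_ring R G"

private lemma carrA: "p \<in> carrier A \<longleftrightarrow> p \<in> carrier G \<rightarrow>\<^sub>E carrier R \<and> finite (S p)"
  by (simp add: group_ring_def)

private lemma in_R: "p \<in> carrier A \<Longrightarrow> g \<in> carrier G \<Longrightarrow> p g \<in> carrier R"
  by (auto simp: carrA)

private lemma fin_S: "p \<in> carrier A \<Longrightarrow> finite (S p)"
  by (simp add: carrA)

private lemma S_sub: "S p \<subseteq> carrier G"
  by (auto simp: coeff_supp_def)

private lemma not_S: "g \<in> carrier G \<Longrightarrow> g \<notin> S p \<Longrightarrow> p g = \<zero>"
  by (auto simp: coeff_supp_def)

private lemma carrA_I: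
  assumes "\<And>g. g \<in> carrier G \<Longrightarrow> f g \<in> carrier R"
    and "finite T" "\<And>g. g \<in> carrier G \<Longrightarrow> g \<notin> T \<Longrightarrow> f g = \<zero>"
  shows "(\<lambda>g \<in> carrier G. f g) \<in> carrier A"
proof -
  have "S (\<lambda>g \<in> carrier G. f g) \<subseteq> T"
    using assms(3) by (auto simp: coeff_supp_def)
  then show ?thesis
    using assms(1,2) finite_subset by (auto simp: carrA)
qed

private lemma eqA_I:
  "p \<in> carrier A \<Longrightarrow> q \<in> carrier A \<Longrightarrow> (\<And>g. g \<in> carrier G \<Longrightarrow> p g = q g) \<Longrightarrow> p = q"
  by (auto simp: carrA intro: PiE_ext)

private lemma mult_wide:
  assumes p: "p \<in> carrier A" and q: "q \<in> carrier A" and g: "g \<in> carrier G"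
    and T: "finite T" "S p \<subseteq> T" "T \<subseteq> carrier G"
  shows "(p \<otimes>\<^bsub>A\<^esub> q) g = (\<Oplus>x\<in>T. p x \<otimes> q (inv\<^bsub>G\<^esub> x \<otimes>\<^bsub>G\<^esub> g))"
proof -
  have "(p \<otimes>\<^bsub>A\<^esub> q) g = (\<Oplus>x\<in>S p. p x \<otimes> q (inv\<^bsub>G\<^esub> x \<otimes>\<^bsub>G\<^esub> g))"
    using g by (simp add: group_ring_def)
  also have "\<dots> = (\<Oplus>x\<in>T. p x \<otimes> q (inv\<^bsub>G\<^esub> x \<otimes>\<^bsub>G\<^esub> g))"
  proof (rule R.add.finprod_mono_neutral_cong_left)
    show "p x \<otimes> q (inv\<^bsub>G\<^esub> x \<otimes>\<^bsub>G\<^esub> g) = \<zero>" if "x \<in> T - S p" for x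
      using that T g q not_S[of x p] in_R[OF q, of "inv\<^bsub>G\<^esub> x \<otimes>\<^bsub>G\<^esub> g"] by auto
    show "(\<lambda>x. p x \<otimes> q (inv\<^bsub>G\<^esub> x \<otimes>\<^bsub>G\<^esub> g)) \<in> T \<rightarrow> carrier R"
      using T g by (auto intro!: R.m_closed in_R[OF p] in_R[OF q])
  qed (use T in auto)
  finally show ?thesis .
qed

private lemma add_at: "g \<in> carrier G \<Longrightarrow> (p \<oplus>\<^bsub>A\<^esub> q) g = p g \<oplus> q g"
  by (simp add: group_ring_def)

private lemma one_at: "g \<in> carrier G \<Longrightarrow> \<one>\<^bsub>A\<^esub> g = (if g = \<one>\<^bsub>G\<^esub> then \<one> else \<zero>)"
  by (simp add: group_ring_def)

private lemma zero_at: "g \<in> carrier G \<Longrightarrow> \<zero>\<^bsub>A\<^esub> g = \<zero>"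
  by (simp add: group_ring_def)

private lemma one_A: "\<one>\<^bsub>A\<^esub> \<in> carrier A"
proof -
  have "(\<lambda>g \<in> carrier G. if g = \<one>\<^bsub>G\<^esub> then \<one> else \<zero>) \<in> carrier A"
    by (rule carrA_I[where T = "{\<one>\<^bsub>G\<^esub>}"]) auto
  then show ?thesis by (simp add: group_ring_def)
qed

private lemma zero_A: "\<zero>\<^bsub>A\<^esub> \<in> carrier A"
proof -
  have "(\<lambda>g \<in> carrier G. \<zero>) \<in> carrier A"
    by (rule carrA_I[where T = "{}"]) auto
  then show ?thesis by (simp add: group_ring_def)
qed

private lemma add_A:
  assumes "p \<in> carrier A" "q \<in> carrier A" shows "p \<oplus>\<^bsub>A\<^esub> q \<in> carrier A"
proof -
  have "(\<lambda>g \<in> carrier G. p g \<oplus> q g) \<in> carrier A"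
    by (rule carrA_I[where T = "S p \<union> S q"]) (use assms in \<open>auto simp: in_R fin_S not_S\<close>)
  then show ?thesis by (simp add: group_ring_def)
qed

private lemma mult_in_R:
  assumes p: "p \<in> carrier A" and q: "q \<in> carrier A" and g: "g \<in> carrier G"
  shows "(p \<otimes>\<^bsub>A\<^esub> q) g \<in> carrier R"
  unfolding mult_wide[OF p q g fin_S[OF p] subset_refl S_sub]
  using g S_sub[of p] by (intro R.finsum_closed) (auto intro!: R.m_closed in_R[OF p] in_R[OF q])

private lemma mult_supp:
  assumes p: "p \<in> carrier A" and q: "q \<in> carrier A" and g: "g \<in> carrier G"
    and n: "g \<notin> (\<lambda>(x, y). x \<otimes>\<^bsub>G\<^esub> y) ` (S p \<times> S q)"
  shows "(p \<otimes>\<^bsub>A\<^esub> q) g = \<zero>"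
  unfolding mult_wide[OF p q g fin_S[OF p] subset_refl S_sub]
proof (rule R.add.finprod_one_eqI)
  fix x assume x: "x \<in> S p"
  then have xc: "x \<in> carrier G" using S_sub by blast
  have "x \<otimes>\<^bsub>G\<^esub> (inv\<^bsub>G\<^esub> x \<otimes>\<^bsub>G\<^esub> g) = g"
    using xc g by (simp add: G.m_assoc[symmetric])
  then have "inv\<^bsub>G\<^esub> x \<otimes>\<^bsub>G\<^esub> g \<notin> S q"
    using n x by force
  then show "p x \<otimes> q (inv\<^bsub>G\<^esub> x \<otimes>\<^bsub>G\<^esub> g) = \<zero>"
    using xc g not_S[of "inv\<^bsub>G\<^esub> x \<otimes>\<^bsub>G\<^esub> g" q] in_R[OF p xc] by simp
qed

private lemma mult_A:
  assumes p: "p \<in> carrier A" and q: "q \<in> carrier A" shows "p \<otimes>\<^bsub>A\<^esub> q \<in> carrier A"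
proof -
  have "(\<lambda>g \<in> carrier G. (p \<otimes>\<^bsub>A\<^esub> q) g) \<in> carrier A"
    by (rule carrA_I[where T = "(\<lambda>(x, y). x \<otimes>\<^bsub>G\<^esub> y) ` (S p \<times> S q)"])
      (use mult_in_R[OF p q] mult_supp[OF p q] fin_S[OF p] fin_S[OF q] in auto)
  then show ?thesis by (simp add: group_ring_def cong: restrict_cong)
qed

private lemma finsum_swap:
  assumes "finite X" "finite Y" "\<And>x y. x \<in> X \<Longrightarrow> y \<in> Y \<Longrightarrow> h x y \<in> carrier R"
  shows "(\<Oplus>x\<in>X. \<Oplus>y\<in>Y. h x y) = (\<Oplus>y\<in>Y. \<Oplus>x\<in>X. h x y)"
  using assms(1,3)
proof (induction X rule: finite_induct)
  case empty
  then show ?case by simp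
next
  case (insert a X)
  have "(\<Oplus>x\<in>insert a X. \<Oplus>y\<in>Y. h x y) = (\<Oplus>y\<in>Y. h a y) \<oplus> (\<Oplus>y\<in>Y. \<Oplus>x\<in>X. h x y)"
    using insert by (subst R.finsum_insert) (auto intro!: R.finsum_closed)
  also have "\<dots> = (\<Oplus>y\<in>Y. h a y \<oplus> (\<Oplus>x\<in>X. h x y))"
    using insert.prems by (intro R.finsum_addf[symmetric]) (auto intro!: R.finsum_closed)
  also have "\<dots> = (\<Oplus>y\<in>Y. \<Oplus>x\<in>insert a X. h x y)"
    by (rule R.add.finprod_cong')
      (use insert in \<open>auto intro!: R.finsum_closed R.finsum_insert[symmetric]\<close>)
  finally show ?case .
qed

private lemma mult_assoc_A:
  assumes p: "p \<in> carrier A" and q: "q \<in> carrier A" and r: "r \<in> carrier A"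
  shows "(p \<otimes>\<^bsub>A\<^esub> q) \<otimes>\<^bsub>A\<^esub> r = p \<otimes>\<^bsub>A\<^esub> (q \<otimes>\<^bsub>A\<^esub> r)"
proof (rule eqA_I)
  fix g assume g: "g \<in> carrier G"
  define T where "T = (\<lambda>(x, y). x \<otimes>\<^bsub>G\<^esub> y) ` (S p \<times> S q)"
  have T: "finite T" "S (p \<otimes>\<^bsub>A\<^esub> q) \<subseteq> T" "T \<subseteq> carrier G"
  proof -
    show "finite T" using fin_S p q by (auto simp: T_def)
    show "S (p \<otimes>\<^bsub>A\<^esub> q) \<subseteq> T"
      using mult_supp[OF p q] S_sub[of "p \<otimes>\<^bsub>A\<^esub> q"]
      unfolding T_def[symmetric] by (auto simp: coeff_supp_def)
    show "T \<subseteq> carrier G" using S_sub[of p] S_sub[of q] by (auto simp: T_def)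
  qed
  have Tc: "z \<in> T \<Longrightarrow> z \<in> carrier G" for z using T by blast
  have Sc: "y \<in> S p \<Longrightarrow> y \<in> carrier G" for y using S_sub by blast
  have cl: "\<And>y. y \<in> carrier G \<Longrightarrow> p y \<in> carrier R"
    "\<And>y z. y \<in> carrier G \<Longrightarrow> z \<in> carrier G \<Longrightarrow> q (inv\<^bsub>G\<^esub> y \<otimes>\<^bsub>G\<^esub> z) \<in> carrier R"
    "\<And>z. z \<in> carrier G \<Longrightarrow> r (inv\<^bsub>G\<^esub> z \<otimes>\<^bsub>G\<^esub> g) \<in> carrier R"
    using g by (auto intro!: in_R[OF p] in_R[OF q] in_R[OF r])
  have "((p \<otimes>\<^bsub>A\<^esub> q) \<otimes>\<^bsub>A\<^esub> r) g = (\<Oplus>z\<in>T. (p \<otimes>\<^bsub>A\<^esub> q) z \<otimes> r (inv\<^bsub>G\<^esub> z \<otimes>\<^bsub>G\<^esub> g))"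
    by (rule mult_wide[OF mult_A[OF p q] r g T])
  also have "\<dots> = (\<Oplus>z\<in>T. \<Oplus>y\<in>S p. p y \<otimes> (q (inv\<^bsub>G\<^esub> y \<otimes>\<^bsub>G\<^esub> z) \<otimes> r (inv\<^bsub>G\<^esub> z \<otimes>\<^bsub>G\<^esub> g)))"
  proof (rule R.add.finprod_cong')
    fix z assume "z \<in> T"
    then have z: "z \<in> carrier G" by (rule Tc)
    show "(p \<otimes>\<^bsub>A\<^esub> q) z \<otimes> r (inv\<^bsub>G\<^esub> z \<otimes>\<^bsub>G\<^esub> g)
      = (\<Oplus>y\<in>S p. p y \<otimes> (q (inv\<^bsub>G\<^esub> y \<otimes>\<^bsub>G\<^esub> z) \<otimes> r (inv\<^bsub>G\<^esub> z \<otimes>\<^bsub>G\<^esub> g)))"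
      unfolding mult_wide[OF p q z fin_S[OF p] subset_refl S_sub]
      using cl Sc z fin_S[OF p]
      by (subst R.finsum_ldistr) (auto intro!: R.add.finprod_cong' R.m_assoc)
  qed (use cl Sc Tc in \<open>auto intro!: R.finsum_closed\<close>)
  also have "\<dots> = (\<Oplus>y\<in>S p. \<Oplus>z\<in>T. p y \<otimes> (q (inv\<^bsub>G\<^esub> y \<otimes>\<^bsub>G\<^esub> z) \<otimes> r (inv\<^bsub>G\<^esub> z \<otimes>\<^bsub>G\<^esub> g)))"
    by (rule finsum_swap) (use cl Sc Tc T fin_S[OF p] in auto)
  also have "\<dots> = (\<Oplus>y\<in>S p. p y \<otimes> (q \<otimes>\<^bsub>A\<^esub> r) (inv\<^bsub>G\<^esub> y \<otimes>\<^bsub>G\<^esub> g))"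
  proof (rule R.add.finprod_cong')
    fix y assume y: "y \<in> S p"
    then have yc: "y \<in> carrier G" by (rule Sc)
    define B where "B = (\<lambda>z. inv\<^bsub>G\<^esub> y \<otimes>\<^bsub>G\<^esub> z) ` T"
    have inj: "inj_on (\<lambda>z. inv\<^bsub>G\<^esub> y \<otimes>\<^bsub>G\<^esub> z) T"
      using yc Tc by (auto intro!: inj_onI)
    have B: "finite B" "S q \<subseteq> B" "B \<subseteq> carrier G"
    proof -
      show "finite B" "B \<subseteq> carrier G" using T yc by (auto simp: B_def)
      show "S q \<subseteq> B"
      proof
        fix w assume w: "w \<in> S q"
        then have "w = inv\<^bsub>G\<^esub> y \<otimes>\<^bsub>G\<^esub> (y \<otimes>\<^bsub>G\<^esub> w)"
          using yc S_sub[of q] by (auto simp: G.m_assoc[symmetric])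
        moreover have "y \<otimes>\<^bsub>G\<^esub> w \<in> T" using y w by (auto simp: T_def)
        ultimately show "w \<in> B" by (auto simp: B_def)
      qed
    qed
    have yg: "inv\<^bsub>G\<^esub> y \<otimes>\<^bsub>G\<^esub> g \<in> carrier G" using yc g by simp
    have "(q \<otimes>\<^bsub>A\<^esub> r) (inv\<^bsub>G\<^esub> y \<otimes>\<^bsub>G\<^esub> g)
      = (\<Oplus>w\<in>B. q w \<otimes> r (inv\<^bsub>G\<^esub> w \<otimes>\<^bsub>G\<^esub> (inv\<^bsub>G\<^esub> y \<otimes>\<^bsub>G\<^esub> g)))"
      by (rule mult_wide[OF q r yg B])
    also have "\<dots> = (\<Oplus>z\<in>T. q (inv\<^bsub>G\<^esub> y \<otimes>\<^bsub>G\<^esub> z)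
        \<otimes> r (inv\<^bsub>G\<^esub> (inv\<^bsub>G\<^esub> y \<otimes>\<^bsub>G\<^esub> z) \<otimes>\<^bsub>G\<^esub> (inv\<^bsub>G\<^esub> y \<otimes>\<^bsub>G\<^esub> g)))"
      unfolding B_def
      by (rule R.add.finprod_reindex[OF _ inj])
        (use Tc yc g in \<open>auto intro!: R.m_closed in_R[OF q] in_R[OF r]\<close>)
    also have "\<dots> = (\<Oplus>z\<in>T. q (inv\<^bsub>G\<^esub> y \<otimes>\<^bsub>G\<^esub> z) \<otimes> r (inv\<^bsub>G\<^esub> z \<otimes>\<^bsub>G\<^esub> g))"
    proof (rule R.add.finprod_cong')
      fix z assume "z \<in> T"
      then have z: "z \<in> carrier G" by (rule Tc)
      have "inv\<^bsub>G\<^esub> (inv\<^bsub>G\<^esub> y \<otimes>\<^bsub>G\<^esub> z) \<otimes>\<^bsub>G\<^esub> (inv\<^bsub>G\<^esub> y \<otimes>\<^bsub>G\<^esub> g)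
        = inv\<^bsub>G\<^esub> z \<otimes>\<^bsub>G\<^esub> (y \<otimes>\<^bsub>G\<^esub> (inv\<^bsub>G\<^esub> y \<otimes>\<^bsub>G\<^esub> g))"
        using z yc g by (simp add: G.inv_mult_group G.m_assoc)
      also have "y \<otimes>\<^bsub>G\<^esub> (inv\<^bsub>G\<^esub> y \<otimes>\<^bsub>G\<^esub> g) = g"
        using yc g by (simp add: G.m_assoc[symmetric])
      finally show "q (inv\<^bsub>G\<^esub> y \<otimes>\<^bsub>G\<^esub> z)
          \<otimes> r (inv\<^bsub>G\<^esub> (inv\<^bsub>G\<^esub> y \<otimes>\<^bsub>G\<^esub> z) \<otimes>\<^bsub>G\<^esub> (inv\<^bsub>G\<^esub> y \<otimes>\<^bsub>G\<^esub> g))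
        = q (inv\<^bsub>G\<^esub> y \<otimes>\<^bsub>G\<^esub> z) \<otimes> r (inv\<^bsub>G\<^esub> z \<otimes>\<^bsub>G\<^esub> g)" by simp
    qed (use cl yc Tc in auto)
    finally have "(q \<otimes>\<^bsub>A\<^esub> r) (inv\<^bsub>G\<^esub> y \<otimes>\<^bsub>G\<^esub> g)
      = (\<Oplus>z\<in>T. q (inv\<^bsub>G\<^esub> y \<otimes>\<^bsub>G\<^esub> z) \<otimes> r (inv\<^bsub>G\<^esub> z \<otimes>\<^bsub>G\<^esub> g))" .
    then show "(\<Oplus>z\<in>T. p y \<otimes> (q (inv\<^bsub>G\<^esub> y \<otimes>\<^bsub>G\<^esub> z) \<otimes> r (inv\<^bsub>G\<^esub> z \<otimes>\<^bsub>G\<^esub> g)))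
      = p y \<otimes> (q \<otimes>\<^bsub>A\<^esub> r) (inv\<^bsub>G\<^esub> y \<otimes>\<^bsub>G\<^esub> g)"
      using cl yc Tc T by (simp add: R.finsum_rdistr Pi_iff)
  qed (use Sc g in \<open>auto intro!: R.m_closed in_R[OF p] in_R[OF mult_A[OF q r]]\<close>)
  also have "\<dots> = (p \<otimes>\<^bsub>A\<^esub> (q \<otimes>\<^bsub>A\<^esub> r)) g"
    by (rule mult_wide[OF p mult_A[OF q r] g fin_S[OF p] subset_refl S_sub, symmetric])
  finally show "((p \<otimes>\<^bsub>A\<^esub> q) \<otimes>\<^bsub>A\<^esub> r) g = (p \<otimes>\<^bsub>A\<^esub> (q \<otimes>\<^bsub>A\<^esub> r)) g" .
qed (simp_all add: mult_A p q r)

private lemma one_mult_A: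
  assumes p: "p \<in> carrier A" shows "\<one>\<^bsub>A\<^esub> \<otimes>\<^bsub>A\<^esub> p = p"
proof (rule eqA_I)
  fix g assume g: "g \<in> carrier G"
  have "(\<one>\<^bsub>A\<^esub> \<otimes>\<^bsub>A\<^esub> p) g = (\<Oplus>x\<in>{\<one>\<^bsub>G\<^esub>}. \<one>\<^bsub>A\<^esub> x \<otimes> p (inv\<^bsub>G\<^esub> x \<otimes>\<^bsub>G\<^esub> g))"
    by (rule mult_wide[OF one_A p g]) (auto simp: coeff_supp_def one_at split: if_splits)
  also have "\<dots> = p g"
    using g in_R[OF p g] by (simp add: one_at)
  finally show "(\<one>\<^bsub>A\<^esub> \<otimes>\<^bsub>A\<^esub> p) g = p g" .
qed (simp_all add: mult_A one_A p)

private lemma mult_one_A: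
  assumes p: "p \<in> carrier A" shows "p \<otimes>\<^bsub>A\<^esub> \<one>\<^bsub>A\<^esub> = p"
proof (rule eqA_I)
  fix g assume g: "g \<in> carrier G"
  have T: "finite (insert g (S p))" "S p \<subseteq> insert g (S p)" "insert g (S p) \<subseteq> carrier G"
    using fin_S[OF p] S_sub[of p] g by auto
  have "(p \<otimes>\<^bsub>A\<^esub> \<one>\<^bsub>A\<^esub>) g = (\<Oplus>x\<in>insert g (S p). p x \<otimes> \<one>\<^bsub>A\<^esub> (inv\<^bsub>G\<^esub> x \<otimes>\<^bsub>G\<^esub> g))"
    by (rule mult_wide[OF p one_A g T])
  also have "\<dots> = (\<Oplus>x\<in>insert g (S p). if g = x then p x else \<zero>)"
  proof (rule R.add.finprod_cong')
    fix x assume "x \<in> insert g (S p)"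
    then have x: "x \<in> carrier G" using T by blast
    have "inv\<^bsub>G\<^esub> x \<otimes>\<^bsub>G\<^esub> g = \<one>\<^bsub>G\<^esub> \<longleftrightarrow> g = x"
      using x g G.inv_solve_left' [of "\<one>\<^bsub>G\<^esub>" x g] by auto
    then show "p x \<otimes> \<one>\<^bsub>A\<^esub> (inv\<^bsub>G\<^esub> x \<otimes>\<^bsub>G\<^esub> g) = (if g = x then p x else \<zero>)"
      using x g in_R[OF p x] by (simp add: one_at)
  qed (use T in_R[OF p] in auto)
  also have "\<dots> = p g"
    by (rule R.finsum_singleton) (use T in_R[OF p] in auto)
  finally show "(p \<otimes>\<^bsub>A\<^esub> \<one>\<^bsub>A\<^esub>) g = p g" .
qed (simp_all add: mult_A one_A p)

private lemma distrib_left_A: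
  assumes p: "p \<in> carrier A" and q: "q \<in> carrier A" and r: "r \<in> carrier A"
  shows "r \<otimes>\<^bsub>A\<^esub> (p \<oplus>\<^bsub>A\<^esub> q) = r \<otimes>\<^bsub>A\<^esub> p \<oplus>\<^bsub>A\<^esub> r \<otimes>\<^bsub>A\<^esub> q"
proof (rule eqA_I)
  fix g assume g: "g \<in> carrier G"
  note w = mult_wide[OF r _ g fin_S[OF r] subset_refl S_sub]
  have Sc: "x \<in> S r \<Longrightarrow> x \<in> carrier G" for x using S_sub by blast
  show "(r \<otimes>\<^bsub>A\<^esub> (p \<oplus>\<^bsub>A\<^esub> q)) g = (r \<otimes>\<^bsub>A\<^esub> p \<oplus>\<^bsub>A\<^esub> r \<otimes>\<^bsub>A\<^esub> q) g"
    unfolding add_at[OF g] w[OF p] w[OF q] w[OF add_A[OF p q]]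
    by (rule trans[OF _ R.finsum_addf], rule R.add.finprod_cong')
      (use Sc g in \<open>auto simp: add_at R.r_distr in_R p q r\<close>)
qed (simp_all add: mult_A add_A p q r)

private lemma distrib_right_A:
  assumes p: "p \<in> carrier A" and q: "q \<in> carrier A" and r: "r \<in> carrier A"
  shows "(p \<oplus>\<^bsub>A\<^esub> q) \<otimes>\<^bsub>A\<^esub> r = p \<otimes>\<^bsub>A\<^esub> r \<oplus>\<^bsub>A\<^esub> q \<otimes>\<^bsub>A\<^esub> r"
proof (rule eqA_I)
  fix g assume g: "g \<in> carrier G"
  define T where "T = S p \<union> S q"
  have T: "finite T" "S p \<subseteq> T" "S q \<subseteq> T" "T \<subseteq> carrier G"
    using fin_S[OF p] fin_S[OF q] S_sub[of p] S_sub[of q] by (auto simp: T_def)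
  have "S (p \<oplus>\<^bsub>A\<^esub> q) \<subseteq> T"
    by (auto simp: T_def coeff_supp_def add_at)
  note w = mult_wide[OF p r g T(1,2,4)] mult_wide[OF q r g T(1,3,4)]
    mult_wide[OF add_A[OF p q] r g T(1) this T(4)]
  have Tc: "x \<in> T \<Longrightarrow> x \<in> carrier G" for x using T by blast
  show "((p \<oplus>\<^bsub>A\<^esub> q) \<otimes>\<^bsub>A\<^esub> r) g = (p \<otimes>\<^bsub>A\<^esub> r \<oplus>\<^bsub>A\<^esub> q \<otimes>\<^bsub>A\<^esub> r) g"
    unfolding add_at[OF g] w
    by (rule trans[OF _ R.finsum_addf], rule R.add.finprod_cong')
      (use Tc g in \<open>auto simp: add_at R.l_distr in_R p q r\<close>)
qed (simp_all add: mult_A add_A p q r)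

lemma group_ring_is_ring: "ring (group_ring R G)"
proof (rule ringI)
  show "abelian_group A"
  proof (rule abelian_groupI)
    fix p assume p: "p \<in> carrier A"
    define m where "m = (\<lambda>g \<in> carrier G. \<ominus> p g)"
    have m: "m \<in> carrier A"
      unfolding m_def
      by (rule carrA_I[where T = "S p"]) (auto simp: in_R p fin_S not_S)
    have "m \<oplus>\<^bsub>A\<^esub> p = \<zero>\<^bsub>A\<^esub>"
      by (rule eqA_I[OF add_A[OF m p] zero_A]) (simp add: add_at zero_at m_def R.l_neg in_R p)
    with m show "\<exists>y\<in>carrier A. y \<oplus>\<^bsub>A\<^esub> p = \<zero>\<^bsub>A\<^esub>" by blast
    show "\<zero>\<^bsub>A\<^esub> \<oplus>\<^bsub>A\<^esub> p = p"
      by (rule eqA_I) (auto simp: add_A p zero_A add_at zero_at in_R)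
  next
    fix p q assume "p \<in> carrier A" "q \<in> carrier A"
    then show "p \<oplus>\<^bsub>A\<^esub> q = q \<oplus>\<^bsub>A\<^esub> p"
      by (intro eqA_I) (auto simp: add_A add_at in_R R.a_comm)
  next
    fix p q r assume "p \<in> carrier A" "q \<in> carrier A" "r \<in> carrier A"
    then show "p \<oplus>\<^bsub>A\<^esub> q \<oplus>\<^bsub>A\<^esub> r = p \<oplus>\<^bsub>A\<^esub> (q \<oplus>\<^bsub>A\<^esub> r)"
      by (intro eqA_I) (auto simp: add_A add_at in_R R.a_assoc)
  qed (auto simp: add_A zero_A)
  show "monoid A"
    by (rule monoidI) (auto simp: mult_A one_A mult_assoc_A one_mult_A mult_one_A)
qed (auto simp: distrib_left_A distrib_right_A)

end

end

theory Submission
  imports Defs "HOL-Computational_Algebra.Primes"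
begin

text \<open>In a strongly \<open>\<Delta>\<close>-clean ring, a unit \<open>u = e + d\<close> has \<open>e = u - d\<close> an invertible idempotent,
  so \<open>e = 1\<close> and every unit is \<open>1\<close> plus an element of \<open>\<Delta>\<close>. Hence a sum of two units lies
  in \<open>\<Delta>\<close>, a sum of an odd number of units is a unit, and for odd \<open>m\<close> we get
  \<open>1 - u\<^sup>m = (1 - u) w\<close> with \<open>w\<close> a unit. Take \<open>u = g \<in> G\<close>. If \<open>g\<^sup>m = 1\<close> with \<open>m\<close> odd, this forces \<open>g = 1\<close>. If \<open>g\<close>
  has infinite order, then \<open>(1 - g\<^sup>3) w\<inverse> = 1 - g\<close>, so the coefficient of \<open>w\<inverse>\<close> at \<open>g\<^bsup>3k\<^esup>\<close> is constant for
  \<open>k < 0\<close> and for \<open>k \<ge> 0\<close>, with a jump by \<open>1\<close> in between, contradicting finite support. For the ring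
  \<open>R\<close>, the augmentation \<open>RG \<rightarrow> R\<close> has a section, so units lift and \<open>\<Delta>(RG)\<close> maps into \<open>\<Delta>(R)\<close>.\<close>

section \<open>The set \<open>\<Delta>\<close>\<close>

context ring
begin

lemma Units_uminus_closed:
  assumes "u \<in> Units R"
  shows "\<ominus> u \<in> Units R"
proof -
  have "(\<ominus> \<one>) \<otimes> u \<in> Units R"
    using assms by (intro Units_m_closed) auto
  then show ?thesis
    using assms by (simp add: l_minus Units_closed)
qed

text \<open>The additive and multiplicative conditions are exchanged by the unit v = -u^{-1}: (1 - x
  v) u = u + x and (v + x)(-u) = 1 - x u. In the additive form several elements of
  \<open>Delta R\<close> can be added to a unit one after another.\<close>

lemma Delta_iff: "x \<in> Delta R \<longleftrightarrow> x \<in> carrier R \<and> (\<forall>u \<in> Units R. u \<oplus> x \<in> Units R)"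
proof (intro iffI conjI ballI)
  assume x: "x \<in> Delta R"
  then show xc: "x \<in> carrier R" by (simp add: Delta_def)
  fix u assume u: "u \<in> Units R"
  define v where "v = \<ominus> (inv u)"
  have v: "v \<in> Units R" "v \<in> carrier R"
    using u Units_uminus_closed Units_closed by (auto simp: v_def)
  have "(\<one> \<ominus> x \<otimes> v) \<otimes> u \<in> Units R"
    using x v u by (intro Units_m_closed) (auto simp: Delta_def)
  also have "(\<one> \<ominus> x \<otimes> v) \<otimes> u = u \<oplus> x \<otimes> (inv u \<otimes> u)"
    using u xc Units_closed[OF u] Units_inv_closed[OF u]
    by (simp add: v_def minus_eq r_minus l_distr m_assoc)
  also have "\<dots> = u \<oplus> x"
    using u xc by simp
  finally show "u \<oplus> x \<in> Units R" .
next
  assume x: "x \<in> carrier R \<and> (\<forall>u \<in> Units R. u \<oplus> x \<in> Units R)"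
  have "\<one> \<ominus> x \<otimes> u \<in> Units R" if u: "u \<in> Units R" for u
  proof -
    define v where "v = \<ominus> (inv u)"
    have v: "v \<in> Units R" "v \<in> carrier R"
      using u Units_uminus_closed Units_closed by (auto simp: v_def)
    have "(v \<oplus> x) \<otimes> (\<ominus> u) \<in> Units R"
      using x v u Units_uminus_closed by (intro Units_m_closed) auto
    also have "(v \<oplus> x) \<otimes> (\<ominus> u) = \<one> \<ominus> x \<otimes> u"
      using u x Units_closed[OF u] Units_inv_closed[OF u]
      by (simp add: v_def minus_eq r_minus l_minus l_distr minus_add)
    finally show ?thesis .
  qed
  with x show "x \<in> Delta R" by (simp add: Delta_def)
qed

lemma Delta_closed: "x \<in> Delta R \<Longrightarrow> x \<in> carrier R"
  by (simp add: Delta_iff)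

lemma Units_add_Delta: "u \<in> Units R \<Longrightarrow> x \<in> Delta R \<Longrightarrow> u \<oplus> x \<in> Units R"
  by (simp add: Delta_iff)

text \<open>Negation preserves units, and u - x = -(-u + x).\<close>

lemma Delta_uminus:
  assumes "x \<in> Delta R"
  shows "\<ominus> x \<in> Delta R"
  unfolding Delta_iff
proof (intro conjI ballI)
  have x: "x \<in> carrier R" using assms by (rule Delta_closed)
  then show "\<ominus> x \<in> carrier R" by simp
  fix u assume u: "u \<in> Units R"
  have "\<ominus> (\<ominus> u \<oplus> x) \<in> Units R"
    using u assms by (intro Units_uminus_closed Units_add_Delta)
  then show "u \<oplus> \<ominus> x \<in> Units R"
    using u x by (simp add: minus_add Units_closed)
qed

section \<open>Units of strongly Delta-clean rings\<close>

lemma Units_idempotent: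
  assumes "e \<in> Units R" "e \<otimes> e = e"
  shows "e = \<one>"
  using assms by (metis Units_closed Units_l_cancel r_one one_closed)

lemma strongly_Delta_clean_Units:
  assumes "strongly_Delta_clean R" "u \<in> Units R"
  obtains d where "d \<in> Delta R" "u = \<one> \<oplus> d"
proof -
  have u: "u \<in> carrier R" using assms by auto
  then obtain e d where e: "e \<in> carrier R" "e \<otimes> e = e" and d: "d \<in> Delta R" and ed: "u = e \<oplus> d"
    using assms(1) unfolding strongly_Delta_clean_def by blast
  have "u \<oplus> \<ominus> d \<in> Units R"
    using assms(2) d by (intro Units_add_Delta Delta_uminus)
  moreover have "u \<oplus> \<ominus> d = e"
    using e d Delta_closed[OF d] by (simp add: ed a_assoc r_neg)
  ultimately have "e = \<one>"
    using e by (intro Units_idempotent) simp_all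
  with d ed show ?thesis by (intro that) auto
qed

text \<open>The sum u + v is a difference d - d' of two elements of \<open>Delta R\<close>, which w
  absorbs one at a time. The extra summand w is what the induction on odd powers supplies.\<close>

lemma Units_add_two_Units:
  assumes "strongly_Delta_clean R" and w: "w \<in> Units R" and u: "u \<in> Units R" and v: "v \<in> Units R"
  shows "w \<oplus> (u \<oplus> v) \<in> Units R"
proof -
  obtain d where d: "d \<in> Delta R" "u = \<one> \<oplus> d"
    using strongly_Delta_clean_Units assms(1) u by blast
  \<comment> \<open>Decomposing -v instead of v makes the two ones cancel in u + v.\<close>
  obtain d' where d': "d' \<in> Delta R" "\<ominus> v = \<one> \<oplus> d'"
    using strongly_Delta_clean_Units assms(1) v Units_uminus_closed by blast
  have c: "d \<in> carrier R" "d' \<in> carrier R" "w \<in> carrier R" "v \<in> carrier R"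
    using d d' w v by (auto simp: Delta_closed)
  have "v = \<ominus> (\<one> \<oplus> d')"
    using c by (simp flip: d'(2))
  then have "u \<oplus> v = d \<oplus> \<ominus> d'"
    using c unfolding d(2) by algebra
  then have "w \<oplus> (u \<oplus> v) = (w \<oplus> d) \<oplus> \<ominus> d'"
    using c by (simp add: a_assoc)
  also have "\<dots> \<in> Units R"
    using w d d' by (intro Units_add_Delta Delta_uminus)
  finally show ?thesis .
qed

text \<open>The witness is the geometric sum 1 + u + ... + u^{m-1}. It starts at the unit 1 and
  grows by two powers of u per induction step, so \<open>Units_add_two_Units\<close> keeps it a
  unit.\<close>

lemma one_minus_odd_pow_Units:
  assumes "strongly_Delta_clean R" and u: "u \<in> Units R" and "odd (m::nat)"
  obtains w where "w \<in> Units R" "\<one> \<ominus> u [^] m = (\<one> \<ominus> u) \<otimes> w"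
proof -
  have uc: "u \<in> carrier R" using u by auto
  have pow: "u [^] n \<in> Units R" for n :: nat
    by (induction n) (use u in auto)
  have "\<exists>w \<in> Units R. \<one> \<ominus> u [^] Suc (2 * n) = (\<one> \<ominus> u) \<otimes> w" for n
  proof (induction n)
    case 0
    then show ?case using uc by (intro bexI[of _ \<one>]) auto
  next
    case (Suc n)
    then obtain w where w: "w \<in> Units R" "\<one> \<ominus> u [^] Suc (2 * n) = (\<one> \<ominus> u) \<otimes> w" by blast
    define y where "y = u [^] Suc (2 * n)"
    have y: "y \<in> Units R" "y \<otimes> u \<in> Units R" "y \<in> carrier R" "u \<otimes> y = y \<otimes> u"
      using pow u uc nat_pow_comm[of u 1 "Suc (2 * n)"] unfolding y_def by (auto simp del: nat_pow_Suc)
    have wc: "w \<in> carrier R" using w by auto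
    \<comment> \<open>The next two terms of the geometric sum are y = u^{2n+1} and y u; multiplied
      by 1 - u they telescope to y - y u u, and y cancels against 1 - y.\<close>
    have "(\<one> \<ominus> u) \<otimes> (w \<oplus> (y \<oplus> y \<otimes> u)) = (\<one> \<ominus> y) \<oplus> (\<one> \<ominus> u) \<otimes> (y \<oplus> y \<otimes> u)"
      using uc y wc w(2)[folded y_def] by (simp add: r_distr)
    also have "(\<one> \<ominus> u) \<otimes> (y \<oplus> y \<otimes> u) = y \<oplus> y \<otimes> u \<ominus> (u \<otimes> y \<oplus> u \<otimes> y \<otimes> u)"
      using uc y(3) by (simp add: r_distr l_distr minus_eq l_minus minus_add m_assoc a_ac)
    also have "\<dots> = y \<ominus> y \<otimes> u \<otimes> u"
      using uc y(3) unfolding y(4) by algebra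
    also have "(\<one> \<ominus> y) \<oplus> (y \<ominus> y \<otimes> u \<otimes> u) = \<one> \<ominus> y \<otimes> u \<otimes> u"
      using uc y(3) by algebra
    also have "y \<otimes> u \<otimes> u = u [^] Suc (2 * Suc n)"
      by (simp add: y_def)
    finally show ?case
      using Units_add_two_Units[OF assms(1) w(1) y(1,2)] by metis
  qed
  moreover obtain n where "m = Suc (2 * n)"
    using \<open>odd m\<close> by (auto elim: oddE)
  ultimately show ?thesis
    using that by blast
qed

end

section \<open>Transfer along retractions of rings\<close>

lemma ring_hom_Units:
  assumes "ring R" "ring S" "h \<in> ring_hom R S" "u \<in> Units R"
  shows "h u \<in> Units S"
proof -
  interpret R: ring R by fact
  interpret S: ring S by fact
  have v: "u \<in> carrier R" "inv\<^bsub>R\<^esub> u \<in> carrier R" using assms(4) by auto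
  have "h (inv\<^bsub>R\<^esub> u) \<otimes>\<^bsub>S\<^esub> h u = \<one>\<^bsub>S\<^esub>" "h u \<otimes>\<^bsub>S\<^esub> h (inv\<^bsub>R\<^esub> u) = \<one>\<^bsub>S\<^esub>"
    using assms(4) v by (simp_all flip: ring_hom_mult[OF assms(3)] add: ring_hom_one[OF assms(3)])
  then show ?thesis
    using v ring_hom_closed[OF assms(3)] unfolding Units_def by blast
qed

text \<open>The section s supplies the units needed: for a unit u of R and d in
  \<open>Delta S\<close>, s u + d is a unit of S whose image is u + h d. Hence h maps
  \<open>Delta S\<close> into \<open>Delta R\<close>, and a decomposition of s a is carried by h to
  one of a.\<close>

lemma strongly_Delta_clean_retract:
  assumes "ring S" "ring R" and h: "h \<in> ring_hom S R" and s: "s \<in> ring_hom R S"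
    and hs: "\<And>r. r \<in> carrier R \<Longrightarrow> h (s r) = r"
    and S: "strongly_Delta_clean S"
  shows "strongly_Delta_clean R"
  unfolding strongly_Delta_clean_def
proof (intro ballI)
  interpret R: ring R by fact
  interpret S: ring S by fact
  note hom = ring_hom_closed[OF h] ring_hom_add[OF h] ring_hom_mult[OF h]
  have Delta: "h d \<in> Delta R" if d: "d \<in> Delta S" for d
    unfolding R.Delta_iff
  proof (intro conjI ballI)
    have dc: "d \<in> carrier S" using d by (rule S.Delta_closed)
    then show "h d \<in> carrier R" by (rule hom)
    fix u assume u: "u \<in> Units R"
    have su: "s u \<in> Units S"
      using ring_hom_Units[OF assms(2,1) s u] .
    then have "h (s u \<oplus>\<^bsub>S\<^esub> d) \<in> Units R"
      using d by (intro ring_hom_Units[OF assms(1,2) h] S.Units_add_Delta)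
    then show "u \<oplus>\<^bsub>R\<^esub> h d \<in> Units R"
      using su u dc by (simp add: hom hs S.Units_closed R.Units_closed)
  qed
  fix a assume a: "a \<in> carrier R"
  then obtain e d where e: "e \<in> carrier S" "e \<otimes>\<^bsub>S\<^esub> e = e" and d: "d \<in> Delta S"
    and ed: "s a = e \<oplus>\<^bsub>S\<^esub> d" "e \<otimes>\<^bsub>S\<^esub> d = d \<otimes>\<^bsub>S\<^esub> e"
    using S ring_hom_closed[OF s] unfolding strongly_Delta_clean_def by meson
  have dc: "d \<in> carrier S" using d by (rule S.Delta_closed)
  have "a = h e \<oplus>\<^bsub>R\<^esub> h d"
    using hs[OF a] e dc by (simp add: ed(1) hom)
  moreover have "h e \<otimes>\<^bsub>R\<^esub> h e = h e" "h e \<otimes>\<^bsub>R\<^esub> h d = h d \<otimes>\<^bsub>R\<^esub> h e"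
    using e dc ed by (simp_all flip: hom(3))
  ultimately show "\<exists>e\<in>carrier R. \<exists>d\<in>Delta R. a = e \<oplus>\<^bsub>R\<^esub> d \<and> e \<otimes>\<^bsub>R\<^esub> e = e \<and> e \<otimes>\<^bsub>R\<^esub> d = d \<otimes>\<^bsub>R\<^esub> e"
    using Delta[OF d] e(1) hom(1) by blast
qed

section \<open>Monomials and augmentation\<close>

text \<open>The formal sum r g. For g outside \<open>carrier G\<close> it degenerates to zero, so
  \<open>monomial_closed\<close> asks nothing of g.\<close>

definition monomial ::
  "('a, 'm) ring_scheme \<Rightarrow> ('g, 'n) monoid_scheme \<Rightarrow> 'a \<Rightarrow> 'g \<Rightarrow> 'g \<Rightarrow> 'a" where
  "monomial R G r g = (\<lambda>h \<in> carrier G. if h = g then r else \<zero>\<^bsub>R\<^esub>)"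

text \<open>The map sending every group element to 1. Summing over the support keeps the index set
  finite even for infinite G.\<close>

definition augmentation ::
  "('a, 'm) ring_scheme \<Rightarrow> ('g, 'n) monoid_scheme \<Rightarrow> ('g \<Rightarrow> 'a) \<Rightarrow> 'a" where
  "augmentation R G p = (\<Oplus>\<^bsub>R\<^esub>g \<in> coeff_supp R G p. p g)"

lemma (in ring) finsum_swap:
  assumes "finite X" "finite Y" "\<And>x y. x \<in> X \<Longrightarrow> y \<in> Y \<Longrightarrow> f x y \<in> carrier R"
  shows "(\<Oplus>x\<in>X. \<Oplus>y\<in>Y. f x y) = (\<Oplus>y\<in>Y. \<Oplus>x\<in>X. f x y)"
  using assms(1,3)
proof (induction X)
  case empty
  then show ?case by simp
next
  case (insert a X)
  have "(\<Oplus>y\<in>Y. \<Oplus>x\<in>insert a X. f x y) = (\<Oplus>y\<in>Y. f a y \<oplus> (\<Oplus>x\<in>X. f x y))"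
    using insert by (intro finsum_cong') (auto intro!: finsum_insert finsum_closed)
  also have "\<dots> = (\<Oplus>y\<in>Y. f a y) \<oplus> (\<Oplus>y\<in>Y. \<Oplus>x\<in>X. f x y)"
    using insert.prems by (intro finsum_addf) (auto intro!: finsum_closed)
  finally show ?case
    using insert by (subst finsum_insert) (auto intro!: finsum_closed)
qed

section \<open>Coefficients and monomials in the group ring\<close>

locale ring_and_group = R: ring R + G: group G
  for R :: "('a, 'm) ring_scheme" (structure) and G :: "('g, 'n) monoid_scheme"
begin

abbreviation "A \<equiv> group_ring R G"

sublocale A: ring A
  by (rule group_ring_is_ring[OF R.ring_axioms G.group_axioms])

lemma carrier_A: "p \<in> carrier A \<longleftrightarrow> p \<in> carrier G \<rightarrow>\<^sub>E carrier R \<and> finite (coeff_supp R G p)"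
  by (simp add: group_ring_def)

lemma coeff_closed: "p \<in> carrier A \<Longrightarrow> g \<in> carrier G \<Longrightarrow> p g \<in> carrier R"
  by (auto simp: carrier_A)

lemma A_eqI:
  "p \<in> carrier A \<Longrightarrow> q \<in> carrier A \<Longrightarrow> (\<And>g. g \<in> carrier G \<Longrightarrow> p g = q g) \<Longrightarrow> p = q"
  by (auto simp: carrier_A intro: PiE_ext)

lemma coeff_add: "g \<in> carrier G \<Longrightarrow> (p \<oplus>\<^bsub>A\<^esub> q) g = p g \<oplus> q g"
  by (simp add: group_ring_def)

lemma coeff_zero: "g \<in> carrier G \<Longrightarrow> \<zero>\<^bsub>A\<^esub> g = \<zero>"
  by (simp add: group_ring_def)

lemma coeff_mult: "g \<in> carrier G \<Longrightarrow>
  (p \<otimes>\<^bsub>A\<^esub> q) g = (\<Oplus>x\<in>coeff_supp R G p. p x \<otimes> q (inv\<^bsub>G\<^esub> x \<otimes>\<^bsub>G\<^esub> g))"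
  by (simp add: group_ring_def)

text \<open>Negation is not a field of the group ring record, so its coefficients are identified by
  uniqueness of additive inverses in R.\<close>

lemma coeff_minus:
  assumes "p \<in> carrier A" "q \<in> carrier A" "g \<in> carrier G"
  shows "(p \<ominus>\<^bsub>A\<^esub> q) g = p g \<ominus> q g"
proof -
  have c: "(\<ominus>\<^bsub>A\<^esub> q) g \<in> carrier R" "p g \<in> carrier R" "q g \<in> carrier R"
    using assms by (simp_all add: coeff_closed)
  have "(\<ominus>\<^bsub>A\<^esub> q) g \<oplus> q g = \<zero>"
    using assms by (simp flip: coeff_add add: A.l_neg coeff_zero)
  then have "(\<ominus>\<^bsub>A\<^esub> q) g = \<ominus> q g"
    using c R.minus_equality by metis
  then show ?thesis
    using assms by (simp add: A.minus_eq R.minus_eq coeff_add)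
qed

lemma one_A: "\<one>\<^bsub>A\<^esub> = monomial R G \<one> \<one>\<^bsub>G\<^esub>"
  by (simp add: group_ring_def monomial_def)

lemma coeff_monomial: "h \<in> carrier G \<Longrightarrow> monomial R G r g h = (if h = g then r else \<zero>)"
  by (simp add: monomial_def)

lemma coeff_supp_monomial: "coeff_supp R G (monomial R G r g) \<subseteq> {g}"
  by (auto simp: coeff_supp_def monomial_def split: if_splits)

lemma monomial_closed:
  assumes "r \<in> carrier R"
  shows "monomial R G r g \<in> carrier A"
  unfolding carrier_A
  using assms finite_subset[OF coeff_supp_monomial[of r g]] by (auto simp: monomial_def)

lemma coeff_monomial_mult:
  assumes r: "r \<in> carrier R" and g: "g \<in> carrier G" and p: "p \<in> carrier A" and h: "h \<in> carrier G"
  shows "(monomial R G r g \<otimes>\<^bsub>A\<^esub> p) h = r \<otimes> p (inv\<^bsub>G\<^esub> g \<otimes>\<^bsub>G\<^esub> h)"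
proof -
  have c: "p (inv\<^bsub>G\<^esub> g \<otimes>\<^bsub>G\<^esub> h) \<in> carrier R"
    using p g h by (simp add: coeff_closed)
  \<comment> \<open>The monomial has support \<open>{g}\<close> only for nonzero r; for r = 0 the
    defining sum is empty.\<close>
  show ?thesis
  proof (cases "r = \<zero>")
    case True
    then have "coeff_supp R G (monomial R G r g) = {}"
      by (simp add: coeff_supp_def monomial_def)
    then show ?thesis
      using True c h by (simp add: coeff_mult)
  next
    case False
    then have "coeff_supp R G (monomial R G r g) = {g}"
      using g by (auto simp: coeff_supp_def monomial_def split: if_splits)
    then show ?thesis
      using c g h r by (simp add: coeff_mult coeff_monomial)
  qed
qed

lemma monomial_mult:
  assumes "r \<in> carrier R" "s \<in> carrier R" "g \<in> carrier G" "h \<in> carrier G"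
  shows "monomial R G r g \<otimes>\<^bsub>A\<^esub> monomial R G s h = monomial R G (r \<otimes> s) (g \<otimes>\<^bsub>G\<^esub> h)"
proof (rule A_eqI)
  fix x assume x: "x \<in> carrier G"
  have "inv\<^bsub>G\<^esub> g \<otimes>\<^bsub>G\<^esub> x = h \<longleftrightarrow> x = g \<otimes>\<^bsub>G\<^esub> h"
    using assms x G.inv_solve_left'[of h g x] by auto
  then show "(monomial R G r g \<otimes>\<^bsub>A\<^esub> monomial R G s h) x = monomial R G (r \<otimes> s) (g \<otimes>\<^bsub>G\<^esub> h) x"
    using assms x by (simp add: coeff_monomial_mult coeff_monomial monomial_closed)
qed (use assms in \<open>simp_all add: monomial_closed\<close>)

lemma monomial_ring_hom: "(\<lambda>r. monomial R G r \<one>\<^bsub>G\<^esub>) \<in> ring_hom R A"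
proof (rule ring_hom_memI)
  fix r s assume rs: "r \<in> carrier R" "s \<in> carrier R"
  show "monomial R G (r \<otimes> s) \<one>\<^bsub>G\<^esub> = monomial R G r \<one>\<^bsub>G\<^esub> \<otimes>\<^bsub>A\<^esub> monomial R G s \<one>\<^bsub>G\<^esub>"
    using rs by (simp add: monomial_mult)
  show "monomial R G (r \<oplus> s) \<one>\<^bsub>G\<^esub> = monomial R G r \<one>\<^bsub>G\<^esub> \<oplus>\<^bsub>A\<^esub> monomial R G s \<one>\<^bsub>G\<^esub>"
    using rs by (intro A_eqI) (auto simp: monomial_closed coeff_add coeff_monomial)
qed (simp_all add: monomial_closed one_A)

lemma monomial_pow:
  assumes "g \<in> carrier G"
  shows "monomial R G \<one> g [^]\<^bsub>A\<^esub> (n::nat) = monomial R G \<one> (g [^]\<^bsub>G\<^esub> n)"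
  by (induction n) (simp_all add: assms one_A monomial_mult)

lemma monomial_Units:
  assumes "g \<in> carrier G"
  shows "monomial R G \<one> g \<in> Units A"
  unfolding Units_def using assms
  by (auto simp: monomial_closed monomial_mult one_A intro!: bexI[of _ "monomial R G \<one> (inv\<^bsub>G\<^esub> g)"])

section \<open>The augmentation homomorphism\<close>

text \<open>Terms outside the support vanish, so one common finite set T can serve several elements
  at once.\<close>

lemma augmentation_eq_finsum:
  assumes "p \<in> carrier A" "finite T" "coeff_supp R G p \<subseteq> T" "T \<subseteq> carrier G"
  shows "augmentation R G p = (\<Oplus>g\<in>T. p g)"
  unfolding augmentation_def
  by (rule R.add.finprod_mono_neutral_cong_left)
    (use assms coeff_closed in \<open>auto simp: coeff_supp_def\<close>)

lemma augmentation_closed: "p \<in> carrier A \<Longrightarrow> augmentation R G p \<in> carrier R"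
  unfolding augmentation_def by (rule R.finsum_closed) (auto simp: coeff_supp_def coeff_closed)

lemma augmentation_monomial:
  assumes "r \<in> carrier R" "g \<in> carrier G"
  shows "augmentation R G (monomial R G r g) = r"
  using assms coeff_supp_monomial[of r g]
  by (simp add: augmentation_eq_finsum[of _ "{g}"] monomial_closed coeff_monomial)

lemma augmentation_add:
  assumes p: "p \<in> carrier A" and q: "q \<in> carrier A"
  shows "augmentation R G (p \<oplus>\<^bsub>A\<^esub> q) = augmentation R G p \<oplus> augmentation R G q"
proof -
  define T where "T = coeff_supp R G p \<union> coeff_supp R G q"
  have T: "finite T" "T \<subseteq> carrier G" "coeff_supp R G p \<subseteq> T" "coeff_supp R G q \<subseteq> T"
    "coeff_supp R G (p \<oplus>\<^bsub>A\<^esub> q) \<subseteq> T"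
    using p q by (auto simp: T_def carrier_A coeff_supp_def coeff_add)
  have "(\<Oplus>g\<in>T. (p \<oplus>\<^bsub>A\<^esub> q) g) = (\<Oplus>g\<in>T. p g \<oplus> q g)"
    using T p q by (intro R.finsum_cong') (auto simp: coeff_add coeff_closed subsetD)
  also have "\<dots> = (\<Oplus>g\<in>T. p g) \<oplus> (\<Oplus>g\<in>T. q g)"
    using T p q by (intro R.finsum_addf) (auto simp: coeff_closed subsetD)
  finally show ?thesis
    using T p q by (simp add: augmentation_eq_finsum[of _ T])
qed

text \<open>After the two sums are interchanged, the substitution g -> x^{-1} g turns the inner sum,
  for each fixed x, into p x times the augmentation of q.\<close>

lemma augmentation_mult:
  assumes p: "p \<in> carrier A" and q: "q \<in> carrier A"
  shows "augmentation R G (p \<otimes>\<^bsub>A\<^esub> q) = augmentation R G p \<otimes> augmentation R G q"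
proof -
  let ?P = "coeff_supp R G p" and ?Q = "coeff_supp R G q"
  \<comment> \<open>The set of products ensures that x^{-1} T covers the support of q for each x in
    the support of p. Adjoining the support of the product makes T admissible for the left-hand side
    by construction.\<close>
  define T where "T = (\<lambda>(x, y). x \<otimes>\<^bsub>G\<^esub> y) ` (?P \<times> ?Q) \<union> coeff_supp R G (p \<otimes>\<^bsub>A\<^esub> q)"
  have P: "finite ?P" "x \<in> ?P \<Longrightarrow> x \<in> carrier G" for x
    using p by (auto simp: carrier_A coeff_supp_def)
  have Q: "finite ?Q" "x \<in> ?Q \<Longrightarrow> x \<in> carrier G" for x
    using q by (auto simp: carrier_A coeff_supp_def)
  have pq: "p \<otimes>\<^bsub>A\<^esub> q \<in> carrier A"
    using p q by simp
  have "finite (coeff_supp R G (p \<otimes>\<^bsub>A\<^esub> q))"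
    using pq by (simp only: carrier_A)
  then have T: "finite T" "T \<subseteq> carrier G"
    using P(1) Q(1) by (auto simp: T_def coeff_supp_def)
  have Tc: "x \<in> T \<Longrightarrow> x \<in> carrier G" for x using T by blast
  have c: "x \<in> carrier G \<Longrightarrow> g \<in> carrier G \<Longrightarrow> q (inv\<^bsub>G\<^esub> x \<otimes>\<^bsub>G\<^esub> g) \<in> carrier R"
    "x \<in> carrier G \<Longrightarrow> p x \<in> carrier R" for x g
    by (simp_all add: coeff_closed[OF p] coeff_closed[OF q])
  have "augmentation R G (p \<otimes>\<^bsub>A\<^esub> q) = (\<Oplus>g\<in>T. (p \<otimes>\<^bsub>A\<^esub> q) g)"
    using pq T by (intro augmentation_eq_finsum) (auto simp: T_def)
  also have "\<dots> = (\<Oplus>g\<in>T. \<Oplus>x\<in>?P. p x \<otimes> q (inv\<^bsub>G\<^esub> x \<otimes>\<^bsub>G\<^esub> g))"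
    using P Tc c by (intro R.finsum_cong') (auto simp: coeff_mult intro!: R.finsum_closed)
  also have "\<dots> = (\<Oplus>x\<in>?P. \<Oplus>g\<in>T. p x \<otimes> q (inv\<^bsub>G\<^esub> x \<otimes>\<^bsub>G\<^esub> g))"
    using P Tc c T by (intro R.finsum_swap) auto
  also have "\<dots> = (\<Oplus>x\<in>?P. p x \<otimes> augmentation R G q)"
  proof (rule R.finsum_cong')
    fix x assume x: "x \<in> ?P"
    then have xc: "x \<in> carrier G" by (rule P)
    let ?T = "(\<lambda>g. inv\<^bsub>G\<^esub> x \<otimes>\<^bsub>G\<^esub> g) ` T"
    have "y \<in> ?T" if "y \<in> ?Q" for y
    proof -
      have "y = inv\<^bsub>G\<^esub> x \<otimes>\<^bsub>G\<^esub> (x \<otimes>\<^bsub>G\<^esub> y)"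
        using xc Q(2)[OF that] by (simp add: G.m_assoc[symmetric])
      moreover have "x \<otimes>\<^bsub>G\<^esub> y \<in> T"
        using x that by (auto simp: T_def)
      ultimately show ?thesis by blast
    qed
    then have "augmentation R G q = (\<Oplus>y\<in>?T. q y)"
      using q T Tc xc by (intro augmentation_eq_finsum) auto
    also have "\<dots> = (\<Oplus>g\<in>T. q (inv\<^bsub>G\<^esub> x \<otimes>\<^bsub>G\<^esub> g))"
      using xc Tc c by (intro R.add.finprod_reindex) (auto intro!: inj_onI)
    finally show "(\<Oplus>g\<in>T. p x \<otimes> q (inv\<^bsub>G\<^esub> x \<otimes>\<^bsub>G\<^esub> g)) = p x \<otimes> augmentation R G q"
      using xc Tc c T by (simp add: R.finsum_rdistr Pi_iff)
  qed (use P c q in \<open>auto simp: augmentation_closed\<close>)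
  also have "\<dots> = augmentation R G p \<otimes> augmentation R G q"
    unfolding augmentation_def[of R G p]
    using P c q by (intro R.finsum_ldistr[symmetric]) (auto simp: augmentation_closed)
  finally show ?thesis .
qed

lemma augmentation_ring_hom: "augmentation R G \<in> ring_hom A R"
  by (rule ring_hom_memI)
    (simp_all add: augmentation_closed augmentation_add augmentation_mult one_A augmentation_monomial)

lemma strongly_Delta_clean_coefficients:
  assumes "strongly_Delta_clean A"
  shows "strongly_Delta_clean R"
  by (rule strongly_Delta_clean_retract[OF A.ring_axioms R.ring_axioms augmentation_ring_hom
        monomial_ring_hom _ assms])
    (simp add: augmentation_monomial)

section \<open>Orders of group elements\<close>

lemma odd_power_eq_one:
  assumes "strongly_Delta_clean A" "\<one> \<noteq> \<zero>" and g: "g \<in> carrier G"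
    and "odd (m::nat)" "g [^]\<^bsub>G\<^esub> m = \<one>\<^bsub>G\<^esub>"
  shows "g = \<one>\<^bsub>G\<^esub>"
proof -
  define u where "u = monomial R G \<one> g"
  have u: "u \<in> Units A" "u \<in> carrier A"
    using g by (simp_all add: u_def monomial_Units monomial_closed)
  obtain w where w: "w \<in> Units A" "\<one>\<^bsub>A\<^esub> \<ominus>\<^bsub>A\<^esub> u [^]\<^bsub>A\<^esub> m = (\<one>\<^bsub>A\<^esub> \<ominus>\<^bsub>A\<^esub> u) \<otimes>\<^bsub>A\<^esub> w"
    using A.one_minus_odd_pow_Units[OF assms(1) u(1) \<open>odd m\<close>] by blast
  have "u [^]\<^bsub>A\<^esub> m = \<one>\<^bsub>A\<^esub>"
    using assms by (simp add: u_def monomial_pow one_A)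
  then have "(\<one>\<^bsub>A\<^esub> \<ominus>\<^bsub>A\<^esub> u) \<otimes>\<^bsub>A\<^esub> w = \<zero>\<^bsub>A\<^esub>"
    using w(2) by (metis A.one_closed A.r_neg A.minus_eq)
  then have "(\<one>\<^bsub>A\<^esub> \<ominus>\<^bsub>A\<^esub> u) \<otimes>\<^bsub>A\<^esub> w \<otimes>\<^bsub>A\<^esub> inv\<^bsub>A\<^esub> w = \<zero>\<^bsub>A\<^esub>"
    using w(1) by simp
  then have "\<one>\<^bsub>A\<^esub> \<ominus>\<^bsub>A\<^esub> u = \<zero>\<^bsub>A\<^esub>"
    using w(1) u(2) by (simp add: A.m_assoc A.Units_closed)
  then have "u = \<one>\<^bsub>A\<^esub>"
    using u(2) by simp
  \<comment> \<open>The coefficient at g is 1 on the left and, unless g is the identity, 0 on the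
    right; these differ because R is nonzero.\<close>
  then have "u g = \<one>\<^bsub>A\<^esub> g" by simp
  then show ?thesis
    using g assms(2) by (simp add: u_def one_A coeff_monomial split: if_splits)
qed

lemma ord_nonzero:
  assumes "strongly_Delta_clean A" "\<one> \<noteq> \<zero>" and g: "g \<in> carrier G"
  shows "G.ord g \<noteq> 0"
proof
  assume ord: "G.ord g = 0"
  \<comment> \<open>\<open>int_pow_eq\<close> compares exponents modulo the order, and congruence
    modulo 0 is equality.\<close>
  have inj: "g [^]\<^bsub>G\<^esub> i = g [^]\<^bsub>G\<^esub> j \<longleftrightarrow> i = j" for i j :: int
    using G.int_pow_eq[OF g, of i j] ord by auto
  define u where "u = monomial R G \<one> g"
  have u: "u \<in> Units A" "u \<in> carrier A"
    using g by (simp_all add: u_def monomial_Units monomial_closed)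
  obtain w where w: "w \<in> Units A" "\<one>\<^bsub>A\<^esub> \<ominus>\<^bsub>A\<^esub> u [^]\<^bsub>A\<^esub> (3::nat) = (\<one>\<^bsub>A\<^esub> \<ominus>\<^bsub>A\<^esub> u) \<otimes>\<^bsub>A\<^esub> w"
    using A.one_minus_odd_pow_Units[OF assms(1) u(1), of 3] by auto
  define f where "f = inv\<^bsub>A\<^esub> w"
  have f: "f \<in> carrier A" using w by (simp add: f_def)
  have fw: "(\<one>\<^bsub>A\<^esub> \<ominus>\<^bsub>A\<^esub> u [^]\<^bsub>A\<^esub> (3::nat)) \<otimes>\<^bsub>A\<^esub> f = \<one>\<^bsub>A\<^esub> \<ominus>\<^bsub>A\<^esub> u"
    using w u by (simp add: f_def A.m_assoc A.Units_closed)
  have "(\<one>\<^bsub>A\<^esub> \<ominus>\<^bsub>A\<^esub> u [^]\<^bsub>A\<^esub> (3::nat)) \<otimes>\<^bsub>A\<^esub> f = f \<ominus>\<^bsub>A\<^esub> u [^]\<^bsub>A\<^esub> (3::nat) \<otimes>\<^bsub>A\<^esub> f"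
    using u f by (simp add: A.minus_eq A.l_distr A.l_minus)
  then have eq: "f \<ominus>\<^bsub>A\<^esub> u [^]\<^bsub>A\<^esub> (3::nat) \<otimes>\<^bsub>A\<^esub> f = \<one>\<^bsub>A\<^esub> \<ominus>\<^bsub>A\<^esub> u"
    using fw by simp
  \<comment> \<open>The coefficients of f along the cyclic subgroup of g form a two-sided sequence,
    on which multiplication by u^3 acts as a shift by 3.\<close>
  define a where "a k = f (g [^]\<^bsub>G\<^esub> (k::int))" for k
  have a: "a k \<in> carrier R" for k
    using f g by (simp add: a_def coeff_closed)
  have rec: "a k \<ominus> a (k - 3) = (if k = 0 then \<one> else \<zero>) \<ominus> (if k = 1 then \<one> else \<zero>)" for k
  proof -
    have gk: "g [^]\<^bsub>G\<^esub> k \<in> carrier G" using g by simp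
    have "inv\<^bsub>G\<^esub> (g [^]\<^bsub>G\<^esub> (3::nat)) \<otimes>\<^bsub>G\<^esub> g [^]\<^bsub>G\<^esub> k = g [^]\<^bsub>G\<^esub> (-3 + k)"
      using g G.int_pow_mult[OF g, of "-3" k] by (simp add: G.int_pow_neg flip: int_pow_int)
    then have "(u [^]\<^bsub>A\<^esub> (3::nat) \<otimes>\<^bsub>A\<^esub> f) (g [^]\<^bsub>G\<^esub> k) = a (k - 3)"
      using f g gk a[of "k - 3"]
      by (simp add: u_def monomial_pow coeff_monomial_mult coeff_closed a_def)
    then have "a k \<ominus> a (k - 3) = (\<one>\<^bsub>A\<^esub> \<ominus>\<^bsub>A\<^esub> u) (g [^]\<^bsub>G\<^esub> k)"
      unfolding eq[symmetric] using u f gk by (simp add: coeff_minus a_def)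
    also have "\<dots> = (if k = 0 then \<one> else \<zero>) \<ominus> (if k = 1 then \<one> else \<zero>)"
      using gk g inj[of k 0] inj[of k 1] coeff_minus[OF A.one_closed u(2) gk]
      by (simp add: one_A u_def coeff_monomial)
    finally show ?thesis .
  qed
  have step: "a k = a (k - 3)" if "k \<noteq> 0" "k \<noteq> 1" for k
    using rec[of k] that a R.r_right_minus_eq[of "a k" "a (k - 3)"] by (simp add: R.minus_eq)
  \<comment> \<open>Both progressions consist of multiples of 3, so they never meet the exception k
    = 1. The other exception, k = 0, is exactly the step from -3 to 0 that separates them.\<close>
  have const: "a (3 * int n) = a 0" "a (- 3 - 3 * int n) = a (- 3)" for n
  proof (induction n)
    case (Suc n)
    { case 1 show ?case using step[of "3 * int (Suc n)"] Suc by simp }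
    { case 2 show ?case using step[of "- 3 - 3 * int n"] Suc by (simp add: algebra_simps) }
  qed simp_all
  \<comment> \<open>Distinct exponents give distinct group elements, so a sequence of nonzero
    coefficients would make the support of f infinite.\<close>
  have vanish: "\<exists>n. a (c n) = \<zero>" if c: "inj c" for c :: "nat \<Rightarrow> int"
  proof (rule ccontr)
    assume "\<nexists>n. a (c n) = \<zero>"
    then have "range (\<lambda>n. g [^]\<^bsub>G\<^esub> c n) \<subseteq> coeff_supp R G f"
      using g by (auto simp: a_def coeff_supp_def)
    moreover have "inj (\<lambda>n. g [^]\<^bsub>G\<^esub> c n)"
      using c by (auto simp: inj_def inj)
    ultimately show False
      using f finite_subset range_inj_infinite by (metis carrier_A)
  qed
  \<comment> \<open>A constant progression with a zero entry is zero throughout, whereas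
    \<open>rec\<close> at k = 0 demands a 0 - a (-3) = 1.\<close>
  have "a 0 = \<zero>" "a (- 3) = \<zero>"
    using vanish[of "\<lambda>n. 3 * int n"] vanish[of "\<lambda>n. - 3 - 3 * int n"]
    by (auto simp: inj_def const)
  then show False
    using rec[of 0] assms(2) by (simp add: R.minus_eq)
qed

text \<open>As the order is nonzero, it factors as 2^k m with m odd. Then g^{2^k} has m-th power 1
  and is itself trivial, so the order divides 2^k; being also a multiple of 2^k, it equals
  2^k.\<close>

lemma two_group_if_strongly_Delta_clean:
  assumes "strongly_Delta_clean A" "\<one> \<noteq> \<zero>"
  shows "two_group G"
  unfolding two_group_def
proof
  fix g assume g: "g \<in> carrier G"
  obtain k m where m: "G.ord g = 2 ^ k * m" "odd m"
    using ord_nonzero[OF assms g] prime_power_canonical[OF two_is_prime_nat, of "G.ord g"]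
    by (auto simp: mult.commute)
  have "(g [^]\<^bsub>G\<^esub> (2 ^ k :: nat)) [^]\<^bsub>G\<^esub> m = \<one>\<^bsub>G\<^esub>"
    using g by (simp add: G.nat_pow_pow flip: m(1))
  then have "g [^]\<^bsub>G\<^esub> (2 ^ k :: nat) = \<one>\<^bsub>G\<^esub>"
    using odd_power_eq_one[OF assms _ m(2)] g by simp
  then have "G.ord g dvd 2 ^ k"
    using g by (simp add: G.pow_eq_id)
  then show "\<exists>k::nat. G.ord g = 2 ^ k"
    using m(1) by (metis dvd_antisym dvd_triv_left)
qed

end

theorem theorem5p2:
  fixes R :: "('a, 'm) ring_scheme" and G :: "('g, 'n) monoid_scheme"
  assumes "ring R" and "carrier R \<noteq> {\<zero>\<^bsub>R\<^esub>}"
    and "group G"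
    and "strongly_Delta_clean (group_ring R G)"
  shows "strongly_Delta_clean R \<and> two_group G"
proof -
  interpret ring R by fact
  interpret ring_and_group R G
    using assms(1,3) by (rule ring_and_group.intro)
  have "\<one>\<^bsub>R\<^esub> \<noteq> \<zero>\<^bsub>R\<^esub>"
    using assms(2) carrier_one_zero by blast
  then show ?thesis
    using assms(4) strongly_Delta_clean_coefficients two_group_if_strongly_Delta_clean by blast
qed

end
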